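(* Let $(M_1^4,g)$ be a 4-dimensional Lorentzian manifold and let $\alpha:I\to M_1^4$ ($I\subset\mathbb{R}$ an open interval) be a null Cartan curve parametrized by pseudo-arc $t$, with Frenet frame $\{\xi=\alpha',N,W_1,W_2\}$ and with nowhere vanishing Cartan curvatures $\sigma_1,\sigma_2$. Let $f:M_1^4\to\mathbb{R}$ be a smooth function that is eikonal along $\alpha$ and has vanishing Hessian, $H^f=0$. If $\alpha$ is a null $f$-eikonal helix in $M_1^4$, then the following hold: (i) $\int\sigma_2\,dt-\dfrac{\sigma_1'}{\sigma_2}$ is a constant function (for any antiderivative $\int\sigma_2\,dt$ of $\sigma_2$ on $I$); (ii) the axis of the null $f$-eikonal helix is, along $\alpha$, $$\nabla f=c\left[(-\sigma_1)\,\xi+N+\left(-\int\sigma_2\,dt\right)W_2\right],$$ where $c=g(\nabla f,\xi)$ is a non-zero constant and $\int\sigma_2\,dt$ is a suitable antiderivative of $\sigma_2$; (iii) $\sigma_1$ is non-constant.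
   Context: $(M_1^4,g)$ is a 4-dimensional Lorentzian manifold (signature $(-,+,+,+)$) with Levi-Civita connection $\nabla$. A curve $\alpha(t)$ is null if $g(\alpha',\alpha')=0$ and $\alpha'(t)\ne0$ for all $t$. Write $\alpha''=\nabla_{\alpha'}\alpha'$, $\alpha'''=\nabla_{\alpha'}\alpha''$. A null curve is parametrized by pseudo-arc if $g(\alpha'',\alpha'')=1$; it is a Cartan curve if $g(\alpha'',\alpha'')\neq0$ and $\{\alpha',\alpha'',\alpha'''\}$ is linearly independent for every $t$. The Frenet frame of a pseudo-arc parametrized Cartan curve is the frame $\{\xi=\alpha',N,W_1,W_2\}$ along $\alpha$, where $N$ is null, $g(\xi,N)=1$, each of $\xi,N$ is orthogonal to each of $W_1,W_2$, $\{W_1,W_2\}$ is orthonormal, and $$\nabla_\xi\xi=W_1,\quad \nabla_\xi N=\sigma_1W_1+\sigma_2W_2,\quad \nabla_\xi W_1=-\sigma_1\xi-N,\quad \nabla_\xi W_2=-\sigma_2\xi .$$ The smooth functions $\sigma_1,\sigma_2$ are the Cartan curvatures of $\alpha$; a prime on them denotes $d/dt$. The gradient $\nabla f$ is defined by $g(\nabla f,X)=X(f)$ for all vector fields $X$. $f$ is eikonal along $\alpha$ if $\|\nabla f\|=\sqrt{|g(\nabla f,\nabla f)|}$ is constant along $\alpha$. The Hessian is $H^f(X,Y)=g(\nabla_X(\mathrm{grad} f),Y)$; $H^f=0$ means that $\nabla f$ is parallel in $M_1^4$. For $f$ eikonal along $\alpha$, $\alpha$ is a null $f$-eikonal helix if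 $g(\nabla f,\xi)$ is a non-zero constant along $\alpha$; then $\nabla f$ is called its axis. *)

theory Defs
  imports "HOL-Analysis.Analysis" "HOL-Library.Function_Algebras"
begin

text \<open>Functions into a real vector space form a real vector space under pointwise operations;
  tangent vectors below are such functions.\<close>

instantiation "fun" :: (type, scaleR) scaleR
begin

definition "scaleR r f = (\<lambda>x. r *\<^sub>R f x)"
instance ..

end

lemma scaleR_fun_apply [simp]: "(r *\<^sub>R f) x = r *\<^sub>R f x"
  by (simp add: scaleR_fun_def)

instance "fun" :: (type, real_vector) real_vector
  by standard (simp_all add: fun_eq_iff scaleR_add_right scaleR_add_left)


section \<open>Smooth maps between normed spaces\<close>

text \<open>Used for open \<open>S\<close> only: the derivatives are taken in the full space.\<close>

primrec Ck_on ::
  "nat \<Rightarrow> 'a::real_normed_vector set \<Rightarrow> ('a \<Rightarrow> 'b::real_normed_vector) \<Rightarrow> bool" where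
  "Ck_on 0 S f \<longleftrightarrow> continuous_on S f"
| "Ck_on (Suc k) S f \<longleftrightarrow>
     (\<forall>x\<in>S. f differentiable (at x)) \<and>
     (\<forall>v. Ck_on k S (\<lambda>x. frechet_derivative f (at x) v))"

definition smooth_on ::
  "'a::real_normed_vector set \<Rightarrow> ('a \<Rightarrow> 'b::real_normed_vector) \<Rightarrow> bool" where
  "smooth_on S f \<longleftrightarrow> (\<forall>k. Ck_on k S f)"


section \<open>Smooth 4-manifolds\<close>

type_synonym 'a chart = "'a set \<times> ('a \<Rightarrow> real^4)"

abbreviation chart_inv :: "'a chart \<Rightarrow> real^4 \<Rightarrow> 'a" where
  "chart_inv c \<equiv> inv_into (fst c) (snd c)"

definition is_chart :: "'a topology \<Rightarrow> 'a chart \<Rightarrow> bool" where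
  "is_chart X c \<longleftrightarrow>
     openin X (fst c) \<and> open (snd c ` fst c) \<and>
     homeomorphic_map (subtopology X (fst c)) (top_of_set (snd c ` fst c)) (snd c)"

definition smooth_manifold :: "'a topology \<Rightarrow> 'a chart set \<Rightarrow> bool" where
  "smooth_manifold X A \<longleftrightarrow>
     Hausdorff_space X \<and> second_countable X \<and>
     (\<forall>c\<in>A. is_chart X c) \<and> (\<Union>c\<in>A. fst c) = topspace X \<and>
     (\<forall>c\<in>A. \<forall>d\<in>A. smooth_on (snd c ` (fst c \<inter> fst d)) (snd d \<circ> chart_inv c))"

definition smooth_function :: "'a chart set \<Rightarrow> ('a \<Rightarrow> real) \<Rightarrow> bool" where
  "smooth_function A f \<longleftrightarrow> (\<forall>c\<in>A. smooth_on (snd c ` fst c) (f \<circ> chart_inv c))"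

text \<open>A chart of the atlas around \<open>p\<close>. The notions defined through it (action of a tangent vector
  on a function, covariant derivatives) do not depend on the choice.\<close>

definition chart_at :: "'a chart set \<Rightarrow> 'a \<Rightarrow> 'a chart" where
  "chart_at A p = (SOME c. c \<in> A \<and> p \<in> fst c)"


section \<open>Tangent vectors\<close>

text \<open>A tangent vector at \<open>p\<close> is the family of its components in the charts around \<open>p\<close>, related by
  the Jacobians of the transition maps. All other entries of the family are \<open>0\<close>, so that equality
  of tangent vectors is equality of functions.\<close>

type_synonym 'a tvec = "'a chart \<Rightarrow> real^4"

definition change_chart :: "'a chart \<Rightarrow> 'a chart \<Rightarrow> 'a \<Rightarrow> real^4 \<Rightarrow> real^4" where
  "change_chart c d p = frechet_derivative (snd d \<circ> chart_inv c) (at (snd c p))"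

definition tangent_space :: "'a chart set \<Rightarrow> 'a \<Rightarrow> 'a tvec set" where
  "tangent_space A p =
     {v. (\<forall>c. \<not> (c \<in> A \<and> p \<in> fst c) \<longrightarrow> v c = 0) \<and>
         (\<forall>c\<in>A. \<forall>d\<in>A. p \<in> fst c \<and> p \<in> fst d \<longrightarrow> v d = change_chart c d p (v c))}"

text \<open>The tangent vector at \<open>p\<close> with components \<open>u\<close> in the chart \<open>c\<close>.\<close>

definition tvec_of :: "'a chart set \<Rightarrow> 'a chart \<Rightarrow> 'a \<Rightarrow> real^4 \<Rightarrow> 'a tvec" where
  "tvec_of A c p u = (\<lambda>d. if d \<in> A \<and> p \<in> fst d then change_chart c d p u else 0)"

definition dir_deriv :: "'a chart set \<Rightarrow> 'a \<Rightarrow> 'a tvec \<Rightarrow> ('a \<Rightarrow> real) \<Rightarrow> real" where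
  "dir_deriv A p v f =
     (let c = chart_at A p in frechet_derivative (f \<circ> chart_inv c) (at (snd c p)) (v c))"


section \<open>Lorentzian metrics\<close>

type_synonym 'a metric = "'a \<Rightarrow> 'a tvec \<Rightarrow> 'a tvec \<Rightarrow> real"

definition lorentz_product :: "'a tvec set \<Rightarrow> ('a tvec \<Rightarrow> 'a tvec \<Rightarrow> real) \<Rightarrow> bool" where
  "lorentz_product T b \<longleftrightarrow>
     (\<forall>u\<in>T. \<forall>v\<in>T. b u v = b v u) \<and>
     (\<forall>u\<in>T. \<forall>v\<in>T. \<forall>w\<in>T. \<forall>r s. b (r *\<^sub>R u + s *\<^sub>R v) w = r * b u w + s * b v w) \<and>
     (\<exists>e :: 4 \<Rightarrow> 'a tvec. \<exists>k. inj e \<and> range e \<subseteq> T \<and> independent (range e) \<and> span (range e) = T \<and>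
        (\<forall>i j. b (e i) (e j) = (if i \<noteq> j then 0 else if i = k then -1 else 1)))"

text \<open>The metric in the chart \<open>c\<close>, as a bilinear form at the point with coordinates \<open>x\<close>.\<close>

definition metric_in_chart ::
  "'a chart set \<Rightarrow> 'a metric \<Rightarrow> 'a chart \<Rightarrow> real^4 \<Rightarrow> real^4 \<Rightarrow> real^4 \<Rightarrow> real" where
  "metric_in_chart A g c x u v =
     g (chart_inv c x) (tvec_of A c (chart_inv c x) u) (tvec_of A c (chart_inv c x) v)"

definition lorentzian_manifold :: "'a topology \<Rightarrow> 'a chart set \<Rightarrow> 'a metric \<Rightarrow> bool" where
  "lorentzian_manifold X A g \<longleftrightarrow>
     smooth_manifold X A \<and>
     (\<forall>p\<in>topspace X. lorentz_product (tangent_space A p) (g p)) \<and>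
     (\<forall>c\<in>A. \<forall>u v. smooth_on (snd c ` fst c) (\<lambda>x. metric_in_chart A g c x u v))"


section \<open>The Levi-Civita connection\<close>

text \<open>Every connection acts in the chart \<open>c\<close> by \<open>\<nabla>\<^sub>u Y = DY u + \<Gamma> u Y\<close> for a bilinear
  \<open>\<Gamma>\<close> depending on the point. The Levi-Civita connection is the unique one that is torsion-free
  (\<open>\<Gamma>\<close> is symmetric) and compatible with the metric.\<close>

definition christoffel ::
  "'a chart set \<Rightarrow> 'a metric \<Rightarrow> 'a chart \<Rightarrow> 'a \<Rightarrow> real^4 \<Rightarrow> real^4 \<Rightarrow> real^4" where
  "christoffel A g c p =
     (THE \<Gamma>. bilinear \<Gamma> \<and> (\<forall>u v. \<Gamma> u v = \<Gamma> v u) \<and>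
        (\<forall>u v w. frechet_derivative (\<lambda>x. metric_in_chart A g c x u v) (at (snd c p)) w =
           metric_in_chart A g c (snd c p) (\<Gamma> w u) v + metric_in_chart A g c (snd c p) u (\<Gamma> w v)))"

definition cov_deriv ::
  "'a chart set \<Rightarrow> 'a metric \<Rightarrow> 'a \<Rightarrow> 'a tvec \<Rightarrow> ('a \<Rightarrow> 'a tvec) \<Rightarrow> 'a tvec" where
  "cov_deriv A g p u Y =
     (let c = chart_at A p in
        tvec_of A c p
          (frechet_derivative (\<lambda>x. Y (chart_inv c x) c) (at (snd c p)) (u c)
            + christoffel A g c p (u c) (Y p c)))"

definition gradient :: "'a chart set \<Rightarrow> 'a metric \<Rightarrow> ('a \<Rightarrow> real) \<Rightarrow> 'a \<Rightarrow> 'a tvec" where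
  "gradient A g f p =
     (THE w. w \<in> tangent_space A p \<and> (\<forall>v\<in>tangent_space A p. g p w v = dir_deriv A p v f))"

definition hessian ::
  "'a chart set \<Rightarrow> 'a metric \<Rightarrow> ('a \<Rightarrow> real) \<Rightarrow> 'a \<Rightarrow> 'a tvec \<Rightarrow> 'a tvec \<Rightarrow> real" where
  "hessian A g f p u v = g p (cov_deriv A g p u (gradient A g f)) v"


section \<open>Curves and vector fields along them\<close>

definition smooth_curve ::
  "'a topology \<Rightarrow> 'a chart set \<Rightarrow> real set \<Rightarrow> (real \<Rightarrow> 'a) \<Rightarrow> bool" where
  "smooth_curve X A I \<alpha> \<longleftrightarrow>
     continuous_map (top_of_set I) X \<alpha> \<and>
     (\<forall>c\<in>A. smooth_on {t\<in>I. \<alpha> t \<in> fst c} (snd c \<circ> \<alpha>))"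

definition velocity :: "'a chart set \<Rightarrow> (real \<Rightarrow> 'a) \<Rightarrow> real \<Rightarrow> 'a tvec" where
  "velocity A \<alpha> t =
     (\<lambda>c. if c \<in> A \<and> \<alpha> t \<in> fst c then vector_derivative (snd c \<circ> \<alpha>) (at t) else 0)"

definition smooth_field_along ::
  "'a chart set \<Rightarrow> real set \<Rightarrow> (real \<Rightarrow> 'a) \<Rightarrow> (real \<Rightarrow> 'a tvec) \<Rightarrow> bool" where
  "smooth_field_along A I \<alpha> V \<longleftrightarrow>
     (\<forall>t\<in>I. V t \<in> tangent_space A (\<alpha> t)) \<and>
     (\<forall>c\<in>A. smooth_on {t\<in>I. \<alpha> t \<in> fst c} (\<lambda>t. V t c))"

definition cov_deriv_along ::
  "'a chart set \<Rightarrow> 'a metric \<Rightarrow> (real \<Rightarrow> 'a) \<Rightarrow> (real \<Rightarrow> 'a tvec) \<Rightarrow> real \<Rightarrow> 'a tvec" where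
  "cov_deriv_along A g \<alpha> V t =
     (let c = chart_at A (\<alpha> t) in
        tvec_of A c (\<alpha> t)
          (vector_derivative (\<lambda>s. V s c) (at t)
            + christoffel A g c (\<alpha> t) (velocity A \<alpha> t c) (V t c)))"


section \<open>Null Cartan curves and their Frenet frames\<close>

definition null_curve ::
  "'a chart set \<Rightarrow> 'a metric \<Rightarrow> real set \<Rightarrow> (real \<Rightarrow> 'a) \<Rightarrow> bool" where
  "null_curve A g I \<alpha> \<longleftrightarrow>
     (\<forall>t\<in>I. g (\<alpha> t) (velocity A \<alpha> t) (velocity A \<alpha> t) = 0 \<and> velocity A \<alpha> t \<noteq> 0)"

definition pseudo_arc_parametrized ::
  "'a chart set \<Rightarrow> 'a metric \<Rightarrow> real set \<Rightarrow> (real \<Rightarrow> 'a) \<Rightarrow> bool" where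
  "pseudo_arc_parametrized A g I \<alpha> \<longleftrightarrow>
     (let acc = cov_deriv_along A g \<alpha> (velocity A \<alpha>) in \<forall>t\<in>I. g (\<alpha> t) (acc t) (acc t) = 1)"

definition cartan_curve ::
  "'a chart set \<Rightarrow> 'a metric \<Rightarrow> real set \<Rightarrow> (real \<Rightarrow> 'a) \<Rightarrow> bool" where
  "cartan_curve A g I \<alpha> \<longleftrightarrow>
     null_curve A g I \<alpha> \<and>
     (let acc = cov_deriv_along A g \<alpha> (velocity A \<alpha>);
          jerk = cov_deriv_along A g \<alpha> acc
      in \<forall>t\<in>I. g (\<alpha> t) (acc t) (acc t) \<noteq> 0 \<and>
           distinct [velocity A \<alpha> t, acc t, jerk t] \<and>
           independent {velocity A \<alpha> t, acc t, jerk t})"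

definition frenet_frame ::
  "'a chart set \<Rightarrow> 'a metric \<Rightarrow> real set \<Rightarrow> (real \<Rightarrow> 'a) \<Rightarrow>
   (real \<Rightarrow> 'a tvec) \<Rightarrow> (real \<Rightarrow> 'a tvec) \<Rightarrow> (real \<Rightarrow> 'a tvec) \<Rightarrow>
   (real \<Rightarrow> real) \<Rightarrow> (real \<Rightarrow> real) \<Rightarrow> bool" where
  "frenet_frame A g I \<alpha> N W1 W2 \<sigma>1 \<sigma>2 \<longleftrightarrow>
     (let \<xi> = velocity A \<alpha>; D = cov_deriv_along A g \<alpha> in
        smooth_field_along A I \<alpha> N \<and> smooth_field_along A I \<alpha> W1 \<and> smooth_field_along A I \<alpha> W2 \<and>
        smooth_on I \<sigma>1 \<and> smooth_on I \<sigma>2 \<and>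
        (\<forall>t\<in>I.
           g (\<alpha> t) (N t) (N t) = 0 \<and> N t \<noteq> 0 \<and> g (\<alpha> t) (\<xi> t) (N t) = 1 \<and>
           g (\<alpha> t) (\<xi> t) (W1 t) = 0 \<and> g (\<alpha> t) (\<xi> t) (W2 t) = 0 \<and>
           g (\<alpha> t) (N t) (W1 t) = 0 \<and> g (\<alpha> t) (N t) (W2 t) = 0 \<and>
           g (\<alpha> t) (W1 t) (W1 t) = 1 \<and> g (\<alpha> t) (W2 t) (W2 t) = 1 \<and>
           g (\<alpha> t) (W1 t) (W2 t) = 0 \<and>
           D \<xi> t = W1 t \<and>
           D N t = \<sigma>1 t *\<^sub>R W1 t + \<sigma>2 t *\<^sub>R W2 t \<and>
           D W1 t = - \<sigma>1 t *\<^sub>R \<xi> t - N t \<and>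
           D W2 t = - \<sigma>2 t *\<^sub>R \<xi> t))"


section \<open>Null eikonal helices\<close>

definition eikonal_along ::
  "'a chart set \<Rightarrow> 'a metric \<Rightarrow> real set \<Rightarrow> (real \<Rightarrow> 'a) \<Rightarrow> ('a \<Rightarrow> real) \<Rightarrow> bool" where
  "eikonal_along A g I \<alpha> f \<longleftrightarrow>
     (\<lambda>t. sqrt \<bar>g (\<alpha> t) (gradient A g f (\<alpha> t)) (gradient A g f (\<alpha> t))\<bar>) constant_on I"

definition null_eikonal_helix ::
  "'a chart set \<Rightarrow> 'a metric \<Rightarrow> real set \<Rightarrow> (real \<Rightarrow> 'a) \<Rightarrow> ('a \<Rightarrow> real) \<Rightarrow> bool" where
  "null_eikonal_helix A g I \<alpha> f \<longleftrightarrow>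
     eikonal_along A g I \<alpha> f \<and>
     (\<exists>c. c \<noteq> 0 \<and> (\<forall>t\<in>I. g (\<alpha> t) (gradient A g f (\<alpha> t)) (velocity A \<alpha> t) = c))"

end

theory Submission
  imports Defs
begin

text \<open>A function with vanishing Hessian has a parallel gradient, so along the curve the field
  \<open>V = \<nabla>f\<close> satisfies \<open>D V = 0\<close>, and for every field \<open>Y\<close> along the curve the derivative of
  \<open>g(V, Y)\<close> is \<open>g(V, D Y)\<close>. Starting with \<open>g(V, \<xi>) = c\<close> and following the Frenet equations, each
  differentiation determines the next component of \<open>V\<close>:
  \<open>g(V, W1) = 0\<close>, then \<open>g(V, N) = - c \<sigma>1\<close>, then \<open>g(V, W2) = - c \<sigma>1' / \<sigma>2\<close>.
  A last differentiation gives \<open>(\<sigma>1' / \<sigma>2)' = \<sigma>2\<close>. Thus \<open>\<sigma>1' / \<sigma>2\<close> is an antiderivative of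
  \<open>\<sigma>2\<close>, and any other one differs from it by a constant. The four components give the axis by
  expansion in the frame. If \<open>\<sigma>1\<close> were constant, the antiderivative \<open>\<sigma>1' / \<sigma>2\<close> would be \<open>0\<close>,
  and so would \<open>\<sigma>2\<close>.

  Most of the work lies in the geometry that this computation takes for granted. The metric in a chart is a
  nondegenerate bilinear form varying with the point. Nondegeneracy yields the Christoffel symbols by the
  Koszul formula (\<open>Koszul_unique_existence\<close>, \<open>christoffel_compatible\<close>) and the
  gradient by representation of functionals (\<open>riesz_nondegenerate\<close>, \<open>gradient_exists\<close>). That
  the gradient is differentiable, without which its covariant derivative would carry no information, follows from
  Cramer's rule (\<open>gradient_differentiable\<close>). The product rule along the curve is
  \<open>metric_has_derivative_along\<close>, and \<open>cov_deriv_along_gradient\<close> transfers the vanishing of the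
  Hessian to the curve.\<close>


section \<open>Linear algebra and calculus of bilinear forms\<close>

text \<open>A nondegenerate form embeds the space into its dual, so finite dimension makes every functional
  representable; \<open>?\<phi>\<close> is this embedding followed by the identification of the dual
  with the space by the Euclidean inner product. Gradients and Christoffel symbols are obtained in
  this way from the metric in a chart.\<close>

lemma riesz_nondegenerate:
  fixes B :: "'a::euclidean_space \<Rightarrow> 'a \<Rightarrow> real"
  assumes B: "bilinear B" and nd: "\<And>u. (\<And>v. B u v = 0) \<Longrightarrow> u = 0" and L: "linear L"
  shows "\<exists>u. \<forall>v. B u v = L v"
proof -
  let ?\<phi> = "\<lambda>u. \<Sum>b\<in>Basis. B u b *\<^sub>R b"
  have B2: "linear (B u)" for u using B by (simp add: bilinear_def)
  have on_Basis: "h = h'" if "linear h" "linear h'" "\<And>b. b \<in> Basis \<Longrightarrow> h b = h' b"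
    for h h' :: "'a \<Rightarrow> real"
    using linear_eq_stdbasis that by blast
  have lin: "linear ?\<phi>"
    by (rule linearI)
      (simp_all add: bilinear_ladd[OF B] bilinear_lmul[OF B] scaleR_add_left sum.distrib scaleR_sum_right)
  have "inj ?\<phi>"
  proof (rule linear_injective_0[OF lin, THEN iffD2], intro allI impI)
    fix u assume "?\<phi> u = 0"
    then have "B u b = 0" if "b \<in> Basis" for b
      using that by (metis inner_sum_left_Basis inner_zero_left)
    then have "B u = (\<lambda>v. 0)" by (intro on_Basis B2) (auto simp: linear_iff)
    then show "u = 0" by (intro nd) simp
  qed
  then have "surj ?\<phi>" using lin by (simp add: linear_injective_imp_surjective)
  then obtain u where u: "(\<Sum>b\<in>Basis. L b *\<^sub>R b) = ?\<phi> u" by (rule surjE)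
  have "B u b = L b" if "b \<in> Basis" for b
    using arg_cong[OF u, of "\<lambda>z. z \<bullet> b"] that by simp
  then have "B u = L" by (intro on_Basis B2 L)
  then show ?thesis by auto
qed

text \<open>The fundamental theorem of (pseudo-)Riemannian geometry at one point: \<open>B\<close> is the metric and
  \<open>D w u v\<close> is the derivative of its \<open>(u, v)\<close> entry in the direction \<open>w\<close>. Permuting the
  three arguments in the compatibility equation and using the symmetry of \<open>\<Gamma>\<close> forces
  \<open>B (\<Gamma> u v)\<close> to be the functional \<open>K u v\<close> of the Koszul formula, and that
  functional is represented by exactly one vector.\<close>

lemma Koszul_unique_existence:
  fixes B :: "'a::euclidean_space \<Rightarrow> 'a \<Rightarrow> real" and D :: "'a \<Rightarrow> 'a \<Rightarrow> 'a \<Rightarrow> real"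
  assumes B: "bilinear B" and sym: "\<And>u v. B u v = B v u"
    and nd: "\<And>u. (\<And>v. B u v = 0) \<Longrightarrow> u = 0"
    and D: "\<And>w. bilinear (D w)" "\<And>u v. linear (\<lambda>w. D w u v)" and Dsym: "\<And>u v w. D w u v = D w v u"
  shows "\<exists>!\<Gamma>. bilinear \<Gamma> \<and> (\<forall>u v. \<Gamma> u v = \<Gamma> v u) \<and>
    (\<forall>u v w. D w u v = B (\<Gamma> w u) v + B u (\<Gamma> w v))"
proof -
  define K where "K u v w = (D u v w + D v u w - D w u v) / 2" for u v w
  note bl = bilinear_ladd[OF B] bilinear_lmul[OF B] bilinear_lsub[OF B]
  note Dl = bilinear_ladd[OF D(1)] bilinear_lmul[OF D(1)] bilinear_radd[OF D(1)] bilinear_rmul[OF D(1)]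
    linear_add[OF D(2)] linear_scale[OF D(2)]
  have eqI: "x = y" if "\<And>w. B x w = B y w" for x y
    using nd[of "x - y"] that by (simp add: bl)
  have "\<exists>x. \<forall>w. B x w = K u v w" for u v
    by (rule riesz_nondegenerate[OF B nd])
      (auto intro!: linearI simp: K_def Dl field_simps)
  then obtain \<Gamma> where \<Gamma>: "\<And>u v w. B (\<Gamma> u v) w = K u v w" by metis
  show ?thesis
  proof (rule ex1I, intro conjI allI)
    show "bilinear \<Gamma>"
      unfolding bilinear_def
      by (intro conjI allI linearI eqI) (simp_all add: bl \<Gamma> K_def Dl field_simps)
    show "\<Gamma> u v = \<Gamma> v u" for u v
      by (intro eqI) (simp add: \<Gamma> K_def Dsym[of _ v u])
    show "D w u v = B (\<Gamma> w u) v + B u (\<Gamma> w v)" for u v w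
      using Dsym[of w v u] Dsym[of u v w] Dsym[of v u w]
      by (simp add: sym[of u "\<Gamma> w v"] \<Gamma> K_def field_simps)
  next
    fix \<Gamma>' assume "bilinear \<Gamma>' \<and> (\<forall>u v. \<Gamma>' u v = \<Gamma>' v u) \<and>
      (\<forall>u v w. D w u v = B (\<Gamma>' w u) v + B u (\<Gamma>' w v))"
    then have *: "\<Gamma>' u v = \<Gamma>' v u" "D w u v = B (\<Gamma>' w u) v + B u (\<Gamma>' w v)" for u v w by blast+
    have "B (\<Gamma>' u v) w = K u v w" for u v w
      using *(2)[of u v w] *(2)[of v u w] *(2)[of w u v] *(1)[of v u] *(1)[of w u] *(1)[of w v]
        sym[of v "\<Gamma>' u w"] sym[of u "\<Gamma>' v w"]
      by (simp add: K_def)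
    then show "\<Gamma>' = \<Gamma>" by (intro ext eqI) (simp add: \<Gamma>)
  qed
qed

text \<open>Pairing with \<open>n\<close>, \<open>l\<close>, \<open>a\<close>, \<open>b\<close> recovers the coefficients of a combination of
  \<open>l\<close>, \<open>n\<close>, \<open>a\<close>, \<open>b\<close>. So the four vectors are independent and, for dimension reasons,
  span. The roles of \<open>l\<close> and \<open>n\<close> are exchanged in the expansion because both are null and
  are dual to each other.\<close>

lemma null_frame_expansion:
  fixes B :: "real^4 \<Rightarrow> real^4 \<Rightarrow> real"
  assumes B: "bilinear B" and sym: "\<And>u v. B u v = B v u"
    and null: "B l l = 0" "B n n = 0" and "B l n = 1"
    and "B l a = 0" "B l b = 0" "B n a = 0" "B n b = 0" "B a a = 1" "B b b = 1" "B a b = 0"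
  shows "x = B x n *\<^sub>R l + B x l *\<^sub>R n + B x a *\<^sub>R a + B x b *\<^sub>R b"
proof -
  define \<Phi> where "\<Phi> u = (u$1) *\<^sub>R l + (u$2) *\<^sub>R n + (u$3) *\<^sub>R a + (u$4) *\<^sub>R b" for u :: "real^4"
  have lin: "linear \<Phi>" by (rule linearI) (simp_all add: \<Phi>_def algebra_simps)
  have sym': "B n l = B l n" "B a l = B l a" "B b l = B l b" "B a n = B n a" "B b n = B n b" "B b a = B a b"
    by (rule sym)+
  have co: "B (\<Phi> u) n = u$1" "B (\<Phi> u) l = u$2" "B (\<Phi> u) a = u$3" "B (\<Phi> u) b = u$4" for u
    using assms(3-) by (simp_all add: \<Phi>_def bilinear_ladd[OF B] bilinear_lmul[OF B] sym')
  have "inj \<Phi>"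
  proof (rule linear_injective_0[OF lin, THEN iffD2], intro allI impI)
    fix u assume "\<Phi> u = 0"
    with co[of u] show "u = 0" by (simp add: vec_eq_iff forall_4 bilinear_lzero[OF B])
  qed
  then have "surj \<Phi>" using lin by (simp add: linear_injective_imp_surjective)
  then obtain u where "x = \<Phi> u" by (rule surjE)
  then show ?thesis by (simp only: co) (simp add: \<Phi>_def)
qed

text \<open>Cramer's rule writes the solution as a quotient of determinants, which are polynomials in the
  entries. This is how the gradient, given only implicitly by the metric and the differential, is seen to be
  a differentiable field.\<close>

lemma differentiable_solution_of_linear_system:
  fixes M :: "'b::real_normed_vector \<Rightarrow> real^'n^'n" and y :: "'b \<Rightarrow> real^'n"
  assumes M: "\<And>i j. (\<lambda>x. M x $ i $ j) differentiable (at x0)"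
    and b: "\<And>i. (\<lambda>x. b x $ i) differentiable (at x0)"
    and S: "open S" "x0 \<in> S" and eq: "\<And>x. x \<in> S \<Longrightarrow> M x *v y x = b x"
    and det: "\<And>x. x \<in> S \<Longrightarrow> det (M x) \<noteq> 0"
  shows "y differentiable (at x0)"
proof -
  have det_diff: "(\<lambda>x. det (C x)) differentiable (at x0)"
    if C: "\<And>i j. (\<lambda>x. C x $ i $ j) differentiable (at x0)" for C :: "'b \<Rightarrow> real^'n^'n"
  proof -
    obtain C' where C': "((\<lambda>x. C x $ i $ j) has_derivative C' i j) (at x0)" for i j
      using C unfolding differentiable_def by metis
    then have *: "\<exists>D. ((\<lambda>x. \<Prod>i\<in>UNIV. C x $ i $ p i) has_derivative D) (at x0)" for p
      using has_derivative_prod[of UNIV "\<lambda>i x. C x $ i $ p i" "\<lambda>i. C' i (p i)" x0 UNIV] C' by blast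
    show ?thesis
      unfolding det_def
      by (intro differentiable_sum finite_permutations ballI differentiable_mult differentiable_const)
        (use * in \<open>auto simp: differentiable_def intro: has_derivative_prod\<close>)
  qed
  let ?z = "\<lambda>x. \<chi> k. det (\<chi> i j. if j = k then b x $ i else M x $ i $ j) / det (M x)"
  have "(\<lambda>x. det (\<chi> i j. if j = k then b x $ i else M x $ i $ j)) differentiable (at x0)" for k
  proof (rule det_diff)
    show "(\<lambda>x. (\<chi> i j. if j = k then b x $ i else M x $ i $ j) $ i $ j) differentiable (at x0)" for i j
      by (cases "j = k") (simp_all add: M b)
  qed
  then have "(\<lambda>x. ?z x $ k) differentiable (at x0)" for k
    using det[OF S(2)] by (simp add: det_diff[OF M])
  then have "?z differentiable (at x0)"
    by (subst differentiable_componentwise_within)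
      (auto simp: Basis_vec_def inner_axis)
  moreover have "?z x = y x" if "x \<in> S" for x
    using cramer[OF det[OF that], of "y x" "b x"] eq[OF that] by simp
  ultimately show ?thesis
    using S unfolding differentiable_def by (blast intro: has_derivative_transform_within_open)
qed

lemma bilinear_expansion_Basis:
  fixes B :: "'a::euclidean_space \<Rightarrow> 'a \<Rightarrow> real"
  assumes "bilinear B"
  shows "B u v = (\<Sum>i\<in>Basis. \<Sum>j\<in>Basis. (u \<bullet> i) * (v \<bullet> j) * B i j)"
proof -
  have "B u v = B (\<Sum>i\<in>Basis. (u \<bullet> i) *\<^sub>R i) (\<Sum>j\<in>Basis. (v \<bullet> j) *\<^sub>R j)"
    by (simp add: euclidean_representation)
  then show ?thesis
    using assms by (simp add: bilinear_sum bilinear_lmul bilinear_rmul sum.cartesian_product mult.assoc)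
qed

text \<open>Each linearity identity holds on the neighbourhood \<open>S\<close>, hence can be differentiated there.
  Outside \<open>S\<close> the function \<open>G\<close> is arbitrary; for a metric in a chart, \<open>S\<close> is the
  range of the chart.\<close>

lemma bilinear_frechet_derivative:
  fixes G :: "'b::real_normed_vector \<Rightarrow> 'a::euclidean_space \<Rightarrow> 'a \<Rightarrow> real"
  assumes S: "open S" "x \<in> S" and bil: "\<And>y. y \<in> S \<Longrightarrow> bilinear (G y)"
    and G: "\<And>u v. (\<lambda>y. G y u v) differentiable (at x)"
  shows "bilinear (\<lambda>u v. frechet_derivative (\<lambda>y. G y u v) (at x) w)"
proof -
  define D where "D u v = frechet_derivative (\<lambda>y. G y u v) (at x)" for u v
  have D: "((\<lambda>y. G y u v) has_derivative D u v) (at x)" for u v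
    using G frechet_derivative_works unfolding D_def by blast
  have D_eqI: "D u v w = D' w"
    if "(h has_derivative D') (at x)" "\<And>y. y \<in> S \<Longrightarrow> h y = G y u v" for u v h D'
    using has_derivative_unique[OF D has_derivative_transform_within_open[OF that(1) S that(2)]]
    by (rule fun_cong)
  have "bilinear (\<lambda>u v. D u v w)"
    unfolding bilinear_def
  proof (intro conjI allI linearI)
    fix u u' v v' :: 'a and r :: real
    show "D u (v + v') w = D u v w + D u v' w"
      by (rule D_eqI[OF has_derivative_add[OF D D]]) (simp add: bilinear_radd[OF bil])
    show "D (u + u') v w = D u v w + D u' v w"
      by (rule D_eqI[OF has_derivative_add[OF D D]]) (simp add: bilinear_ladd[OF bil])
    show "D u (r *\<^sub>R v) w = r *\<^sub>R D u v w"
      by (rule D_eqI[OF has_derivative_scaleR_right[OF D]]) (simp add: bilinear_rmul[OF bil])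
    show "D (r *\<^sub>R u) v w = r *\<^sub>R D u v w"
      by (rule D_eqI[OF has_derivative_scaleR_right[OF D]]) (simp add: bilinear_lmul[OF bil])
  qed
  then show ?thesis by (simp add: D_def)
qed

lemma has_vector_derivative_compose:
  assumes "(x has_vector_derivative x') (at t)" "(h has_derivative h') (at (x t))"
  shows "((\<lambda>s. h (x s)) has_vector_derivative h' x') (at t)"
  using vector_derivative_diff_chain_within[of x x' t UNIV h h'] assms
  by (auto simp: o_def intro: has_derivative_at_withinI)

text \<open>The product rule for a bilinear form that depends on a base point. Expanding \<open>G\<close> in a basis
  reduces it to products of real functions, so separate differentiability of each entry of \<open>G\<close>
  at the point suffices.\<close>

lemma has_vector_derivative_varying_bilinear:
  fixes G :: "'b::real_normed_vector \<Rightarrow> 'a::euclidean_space \<Rightarrow> 'a \<Rightarrow> real"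
  assumes S: "open S" "x t \<in> S" and bil: "\<And>y. y \<in> S \<Longrightarrow> bilinear (G y)"
    and G: "\<And>u v. (\<lambda>y. G y u v) differentiable (at (x t))"
    and x: "(x has_vector_derivative x') (at t)"
    and U: "(U has_vector_derivative U') (at t)" and V: "(V has_vector_derivative V') (at t)"
  shows "((\<lambda>s. G (x s) (U s) (V s)) has_real_derivative
    frechet_derivative (\<lambda>y. G y (U t) (V t)) (at (x t)) x' + G (x t) U' (V t) + G (x t) (U t) V') (at t)"
proof -
  define dG where "dG u v = frechet_derivative (\<lambda>y. G y u v) (at (x t)) x'" for u v
  have dG: "((\<lambda>s. G (x s) u v) has_real_derivative dG u v) (at t)" for u v
    using has_vector_derivative_compose[OF x frechet_derivative_works[THEN iffD1, OF G[of u v]]]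
    by (simp add: dG_def has_real_derivative_iff_has_vector_derivative)
  have "bilinear dG"
    using bilinear_frechet_derivative[OF S bil G] by (simp add: dG_def[abs_def])
  note expand = bilinear_expansion_Basis[OF this] bilinear_expansion_Basis[OF bil]
  have dU: "((\<lambda>s. U s \<bullet> i) has_real_derivative U' \<bullet> i) (at t)"
    and dV: "((\<lambda>s. V s \<bullet> i) has_real_derivative V' \<bullet> i) (at t)" for i
    using bounded_linear.has_vector_derivative[OF bounded_linear_inner_left U]
      bounded_linear.has_vector_derivative[OF bounded_linear_inner_left V]
    by (simp_all add: has_real_derivative_iff_has_vector_derivative)
  obtain T where T: "open T" "t \<in> T" "x ` T \<subseteq> S"
  proof -
    have "isCont x t" using x by (rule has_vector_derivative_continuous)
    then show ?thesis using S that by (metis continuous_at_open image_subsetI)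
  qed
  have "((\<lambda>s. \<Sum>i\<in>Basis. \<Sum>j\<in>Basis. (U s \<bullet> i) * (V s \<bullet> j) * G (x s) i j) has_real_derivative
      (\<Sum>i\<in>Basis. \<Sum>j\<in>Basis. (U t \<bullet> i) * (V t \<bullet> j) * dG i j + (U' \<bullet> i) * (V t \<bullet> j) * G (x t) i j
         + (U t \<bullet> i) * (V' \<bullet> j) * G (x t) i j)) (at t)"
    by (intro DERIV_sum DERIV_cong[OF DERIV_mult[OF DERIV_mult[OF dU dV] dG]]) (simp add: algebra_simps)
  then have "((\<lambda>s. G (x s) (U s) (V s)) has_real_derivative
      (\<Sum>i\<in>Basis. \<Sum>j\<in>Basis. (U t \<bullet> i) * (V t \<bullet> j) * dG i j + (U' \<bullet> i) * (V t \<bullet> j) * G (x t) i j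
         + (U t \<bullet> i) * (V' \<bullet> j) * G (x t) i j)) (at t)"
    by (rule has_field_derivative_transform_within_open[OF _ T(1,2)]) (use T(3) in \<open>auto intro!: expand(2)[symmetric]\<close>)
  then show ?thesis
    by (simp only: sum.distrib expand[symmetric] S(2) dG_def[symmetric])
qed


section \<open>Charts and tangent spaces of a smooth manifold\<close>

lemma smooth_on_imp_differentiable:
  assumes "smooth_on S f" "x \<in> S"
  shows "f differentiable (at x)"
proof -
  have "Ck_on (Suc 0) S f" using assms(1) unfolding smooth_on_def by blast
  then show ?thesis using assms(2) by simp
qed

text \<open>Needed for second derivatives: the velocity of a curve and the differential of a function are
  themselves differentiable.\<close>

lemma smooth_on_imp_differentiable_frechet_derivative:
  assumes "smooth_on S f" "x \<in> S"
  shows "(\<lambda>y. frechet_derivative f (at y) v) differentiable (at x)"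
proof -
  have "Ck_on (Suc (Suc 0)) S f" using assms(1) unfolding smooth_on_def by blast
  then show ?thesis using assms(2) by simp
qed

locale smooth_atlas =
  fixes X :: "'a topology" and A :: "'a chart set"
  assumes smooth_manifold: "smooth_manifold X A"
begin

lemma is_chart: "c \<in> A \<Longrightarrow> is_chart X c"
  using smooth_manifold by (simp add: smooth_manifold_def)

lemma openin_chart_domain: "c \<in> A \<Longrightarrow> openin X (fst c)"
  using is_chart by (simp add: is_chart_def)

lemma chart_inv_chart [simp]:
  assumes "c \<in> A" "p \<in> fst c"
  shows "chart_inv c (snd c p) = p"
proof -
  have "topspace (subtopology X (fst c)) = fst c"
    using openin_chart_domain[OF assms(1)] openin_subset by fastforce
  then have "inj_on (snd c) (fst c)"
    using is_chart[OF assms(1)] homeomorphic_imp_injective_map unfolding is_chart_def by metis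
  then show ?thesis using assms(2) by simp
qed

lemma open_chart_image:
  assumes c: "c \<in> A" and U: "openin X U"
  shows "open (snd c ` (fst c \<inter> U))"
proof -
  have "open_map (subtopology X (fst c)) (top_of_set (snd c ` fst c)) (snd c)"
    using is_chart[OF c] homeomorphic_imp_open_map unfolding is_chart_def by blast
  moreover have "openin (subtopology X (fst c)) (fst c \<inter> U)"
    using U by (metis openin_subtopology_Int2)
  ultimately have "openin (top_of_set (snd c ` fst c)) (snd c ` (fst c \<inter> U))"
    unfolding open_map_def by blast
  then show ?thesis
    using is_chart[OF c] openin_open_eq unfolding is_chart_def by blast
qed

lemma open_chart_range: "c \<in> A \<Longrightarrow> open (snd c ` fst c)"
  using is_chart by (simp add: is_chart_def)

lemma chart_domain_subset: "c \<in> A \<Longrightarrow> p \<in> fst c \<Longrightarrow> p \<in> topspace X"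
  using openin_chart_domain openin_subset by blast

lemma chart_at:
  assumes "p \<in> topspace X"
  shows "chart_at A p \<in> A" "p \<in> fst (chart_at A p)"
proof -
  have "\<exists>c. c \<in> A \<and> p \<in> fst c"
    using assms smooth_manifold unfolding smooth_manifold_def by blast
  from someI_ex[OF this] show "chart_at A p \<in> A" "p \<in> fst (chart_at A p)"
    by (simp_all add: chart_at_def)
qed

lemma transition_has_derivative:
  assumes "c \<in> A" "d \<in> A" "p \<in> fst c" "p \<in> fst d"
  shows "((snd d \<circ> chart_inv c) has_derivative change_chart c d p) (at (snd c p))"
proof -
  have "smooth_on (snd c ` (fst c \<inter> fst d)) (snd d \<circ> chart_inv c)"
    using smooth_manifold assms by (simp add: smooth_manifold_def)
  then have "(snd d \<circ> chart_inv c) differentiable (at (snd c p))"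
    by (rule smooth_on_imp_differentiable) (use assms in auto)
  then show ?thesis unfolding change_chart_def by (simp add: frechet_derivative_works)
qed

lemma linear_change_chart:
  "c \<in> A \<Longrightarrow> d \<in> A \<Longrightarrow> p \<in> fst c \<Longrightarrow> p \<in> fst d \<Longrightarrow> linear (change_chart c d p)"
  using transition_has_derivative has_derivative_linear by blast

lemma change_chart_self:
  assumes "c \<in> A" "p \<in> fst c"
  shows "change_chart c c p u = u"
proof -
  have "((snd c \<circ> chart_inv c) has_derivative (\<lambda>u. u)) (at (snd c p))"
    by (rule has_derivative_transform_within_open[OF has_derivative_ident open_chart_range[OF assms(1)]])
      (use assms in \<open>auto simp: f_inv_into_f\<close>)
  from has_derivative_unique[OF this transition_has_derivative[OF assms(1,1,2,2)]]
  show ?thesis by metis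
qed

text \<open>The two coordinate expressions of \<open>h\<close> differ by the transition map near the point: the
  common domain of the two charts has an open image. The lemma yields both the cocycle law of the Jacobians
  (for \<open>h\<close> a third chart) and the independence of directional derivatives from the chart (for
  \<open>h\<close> a function).\<close>

lemma has_derivative_change_chart:
  assumes c: "c \<in> A" "p \<in> fst c" and d: "d \<in> A" "p \<in> fst d"
    and h: "((h \<circ> chart_inv d) has_derivative h') (at (snd d p))"
  shows "((h \<circ> chart_inv c) has_derivative (h' \<circ> change_chart c d p)) (at (snd c p))"
proof (rule has_derivative_transform_within_open)
  show "((h \<circ> chart_inv d) \<circ> (snd d \<circ> chart_inv c) has_derivative (h' \<circ> change_chart c d p)) (at (snd c p))"
    by (rule diff_chain_at[OF transition_has_derivative]) (use c d h in auto)
  show "open (snd c ` (fst c \<inter> fst d))"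
    by (rule open_chart_image[OF c(1) openin_chart_domain[OF d(1)]])
qed (use c d in auto)

lemma change_chart_change_chart:
  assumes "c \<in> A" "d \<in> A" "e \<in> A" "p \<in> fst c" "p \<in> fst d" "p \<in> fst e"
  shows "change_chart d e p (change_chart c d p u) = change_chart c e p u"
proof -
  have "((snd e \<circ> chart_inv c) has_derivative (change_chart d e p \<circ> change_chart c d p)) (at (snd c p))"
    by (rule has_derivative_change_chart)
      (use assms transition_has_derivative in blast)+
  from has_derivative_unique[OF this transition_has_derivative] assms
  show ?thesis by (simp add: fun_eq_iff)
qed

lemma tangent_space_outside:
  "v \<in> tangent_space A p \<Longrightarrow> \<not> (c \<in> A \<and> p \<in> fst c) \<Longrightarrow> v c = 0"
  unfolding tangent_space_def by blast

lemma tangent_space_change_chart: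
  "v \<in> tangent_space A p \<Longrightarrow> c \<in> A \<Longrightarrow> d \<in> A \<Longrightarrow> p \<in> fst c \<Longrightarrow> p \<in> fst d \<Longrightarrow>
    v d = change_chart c d p (v c)"
  unfolding tangent_space_def by blast

text \<open>The cocycle law makes the transported components a compatible family. Together with
  \<open>tvec_of_chart\<close> and \<open>tvec_of_component\<close> below, each chart around \<open>p\<close> thus identifies
  the tangent space with the coordinate space, which allows all later arguments to be made in coordinates.\<close>

lemma tvec_of_in_tangent_space:
  "c \<in> A \<Longrightarrow> p \<in> fst c \<Longrightarrow> tvec_of A c p u \<in> tangent_space A p"
  by (auto simp: tangent_space_def tvec_of_def change_chart_change_chart)

lemma tvec_of_chart [simp]: "c \<in> A \<Longrightarrow> p \<in> fst c \<Longrightarrow> tvec_of A c p u c = u"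
  by (simp add: tvec_of_def change_chart_self)

lemma tvec_of_component:
  "c \<in> A \<Longrightarrow> p \<in> fst c \<Longrightarrow> v \<in> tangent_space A p \<Longrightarrow> tvec_of A c p (v c) = v"
  by (rule ext)
    (simp add: tvec_of_def tangent_space_outside tangent_space_change_chart[symmetric])

lemma tangent_vector_eqI:
  assumes "c \<in> A" "p \<in> fst c" "u \<in> tangent_space A p" "v \<in> tangent_space A p" "u c = v c"
  shows "u = v"
  using assms tvec_of_component by metis

lemma tangent_space_lincomb:
  assumes "u \<in> tangent_space A p" "v \<in> tangent_space A p"
  shows "r *\<^sub>R u + s *\<^sub>R v \<in> tangent_space A p"
proof -
  have "(r *\<^sub>R u + s *\<^sub>R v) d = change_chart c d p ((r *\<^sub>R u + s *\<^sub>R v) c)"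
    if "c \<in> A" "d \<in> A" "p \<in> fst c" "p \<in> fst d" for c d
    using tangent_space_change_chart[OF assms(1) that] tangent_space_change_chart[OF assms(2) that]
    by (simp add: linear_add[OF linear_change_chart] linear_scale[OF linear_change_chart] that)
  moreover have "(r *\<^sub>R u + s *\<^sub>R v) c = 0" if "\<not> (c \<in> A \<and> p \<in> fst c)" for c
    using assms[THEN tangent_space_outside, OF that] by simp
  ultimately show ?thesis unfolding tangent_space_def by blast
qed

lemma tangent_space_add: "u \<in> tangent_space A p \<Longrightarrow> v \<in> tangent_space A p \<Longrightarrow> u + v \<in> tangent_space A p"
  using tangent_space_lincomb[of u p v 1 1] by simp

lemma tangent_space_scaleR: "u \<in> tangent_space A p \<Longrightarrow> r *\<^sub>R u \<in> tangent_space A p"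
  using tangent_space_lincomb[of u p u r 0] by simp

lemma tvec_of_lincomb:
  "c \<in> A \<Longrightarrow> p \<in> fst c \<Longrightarrow>
    tvec_of A c p (r *\<^sub>R u + s *\<^sub>R v) = r *\<^sub>R tvec_of A c p u + s *\<^sub>R tvec_of A c p v"
  by (rule tangent_vector_eqI[of c p]) (auto intro: tvec_of_in_tangent_space tangent_space_lincomb)

lemma smooth_function_has_derivative:
  assumes "c \<in> A" "p \<in> fst c" "smooth_function A f"
  shows "((f \<circ> chart_inv c) has_derivative frechet_derivative (f \<circ> chart_inv c) (at (snd c p))) (at (snd c p))"
proof -
  have "smooth_on (snd c ` fst c) (f \<circ> chart_inv c)"
    using assms by (simp add: smooth_function_def)
  then show ?thesis
    using assms by (simp add: smooth_on_imp_differentiable frechet_derivative_works[symmetric])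
qed

lemma dir_deriv_in_chart:
  assumes c: "c \<in> A" "p \<in> fst c" and f: "smooth_function A f" and v: "v \<in> tangent_space A p"
  shows "dir_deriv A p v f = frechet_derivative (f \<circ> chart_inv c) (at (snd c p)) (v c)"
proof -
  define d where "d = chart_at A p"
  have d: "d \<in> A" "p \<in> fst d"
    unfolding d_def using c chart_at chart_domain_subset by blast+
  have "((f \<circ> chart_inv c) has_derivative
    (frechet_derivative (f \<circ> chart_inv d) (at (snd d p)) \<circ> change_chart c d p)) (at (snd c p))"
    by (rule has_derivative_change_chart[OF c d smooth_function_has_derivative[OF d f]])
  moreover have "v d = change_chart c d p (v c)"
    using tangent_space_change_chart[OF v] c d by blast
  ultimately show ?thesis
    by (simp add: dir_deriv_def d_def[symmetric] frechet_derivative_at[symmetric])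
qed

end


section \<open>Metric, connection and gradient of a Lorentzian manifold\<close>

locale lorentzian_manifold_locale =
  fixes X :: "'a topology" and A :: "'a chart set" and g :: "'a metric"
  assumes lorentzian_manifold: "lorentzian_manifold X A g"
begin

sublocale smooth_atlas X A
  using lorentzian_manifold by unfold_locales (simp add: lorentzian_manifold_def)

abbreviation G :: "'a chart \<Rightarrow> real^4 \<Rightarrow> real^4 \<Rightarrow> real^4 \<Rightarrow> real" where
  "G \<equiv> metric_in_chart A g"

lemma lorentz_product_metric: "p \<in> topspace X \<Longrightarrow> lorentz_product (tangent_space A p) (g p)"
  using lorentzian_manifold by (simp add: lorentzian_manifold_def)

lemma metric_sym:
  "p \<in> topspace X \<Longrightarrow> u \<in> tangent_space A p \<Longrightarrow> v \<in> tangent_space A p \<Longrightarrow> g p u v = g p v u"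
  using lorentz_product_metric unfolding lorentz_product_def by blast

lemma metric_lincomb_left:
  "p \<in> topspace X \<Longrightarrow> u \<in> tangent_space A p \<Longrightarrow> v \<in> tangent_space A p \<Longrightarrow> w \<in> tangent_space A p \<Longrightarrow>
    g p (r *\<^sub>R u + s *\<^sub>R v) w = r * g p u w + s * g p v w"
  using lorentz_product_metric unfolding lorentz_product_def by blast

lemma metric_add_left:
  "p \<in> topspace X \<Longrightarrow> u \<in> tangent_space A p \<Longrightarrow> v \<in> tangent_space A p \<Longrightarrow> w \<in> tangent_space A p \<Longrightarrow>
    g p (u + v) w = g p u w + g p v w"
  using metric_lincomb_left[of p u v w 1 1] by simp

lemma metric_scaleR_left:
  "p \<in> topspace X \<Longrightarrow> u \<in> tangent_space A p \<Longrightarrow> w \<in> tangent_space A p \<Longrightarrow>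
    g p (r *\<^sub>R u) w = r * g p u w"
  using metric_lincomb_left[of p u u w r 0] by simp

lemma metric_lincomb_right:
  "p \<in> topspace X \<Longrightarrow> u \<in> tangent_space A p \<Longrightarrow> v \<in> tangent_space A p \<Longrightarrow> w \<in> tangent_space A p \<Longrightarrow>
    g p w (r *\<^sub>R u + s *\<^sub>R v) = r * g p w u + s * g p w v"
  using metric_lincomb_left tangent_space_lincomb metric_sym by metis

text \<open>In an orthonormal basis, pairing with the basis vector \<open>e j\<close> isolates the coefficient
  at \<open>j\<close> up to sign.\<close>

lemma metric_nondegenerate:
  assumes p: "p \<in> topspace X" and w: "w \<in> tangent_space A p"
    and orth: "\<And>v. v \<in> tangent_space A p \<Longrightarrow> g p w v = 0"
  shows "w = 0"
proof -
  obtain e :: "4 \<Rightarrow> 'a tvec" and k where e: "inj e" "range e \<subseteq> tangent_space A p"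
    "span (range e) = tangent_space A p"
    "\<forall>i j. g p (e i) (e j) = (if i \<noteq> j then 0 else if i = k then -1 else 1)"
    using lorentz_product_metric[OF p] unfolding lorentz_product_def by (elim conjE exE) (rule that)
  have eT: "e i \<in> tangent_space A p" for i using e(2) by blast
  have sum: "(\<Sum>i\<in>F. r i *\<^sub>R e i) \<in> tangent_space A p \<and>
      g p (\<Sum>i\<in>F. r i *\<^sub>R e i) (e j) = (\<Sum>i\<in>F. r i * g p (e i) (e j))"
    if "finite F" for F r j
    using that
  proof induction
    case empty
    have "g p 0 (e j) = 0" "0 \<in> tangent_space A p"
      using metric_lincomb_left[OF p eT eT eT, of 0 j 0 j j] tangent_space_scaleR[OF eT, of 0 j]
      by simp_all
    then show ?case by (simp only: sum.empty)
  next
    case (insert i F)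
    let ?S = "\<Sum>i\<in>F. r i *\<^sub>R e i"
    have S: "?S \<in> tangent_space A p" "g p ?S (e j) = (\<Sum>i\<in>F. r i * g p (e i) (e j))"
      using insert.IH by blast+
    have ri: "r i *\<^sub>R e i \<in> tangent_space A p" by (rule tangent_space_scaleR[OF eT])
    have "r i *\<^sub>R e i + ?S \<in> tangent_space A p" by (rule tangent_space_add[OF ri S(1)])
    moreover have "g p (r i *\<^sub>R e i + ?S) (e j) = r i * g p (e i) (e j) + (\<Sum>i\<in>F. r i * g p (e i) (e j))"
      by (simp only: metric_add_left[OF p ri S(1) eT] metric_scaleR_left[OF p eT eT] S(2))
    ultimately show ?case by (simp only: sum.insert[OF insert.hyps])
  qed
  have "w \<in> range (\<lambda>r. \<Sum>v\<in>range e. r v *\<^sub>R v)"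
    using w e(3) span_finite[of "range e"] by simp
  then obtain r where r: "w = (\<Sum>i\<in>UNIV. r i *\<^sub>R e i)"
    using e(1) by (auto simp: sum.reindex)
  have "r j = 0" for j
  proof -
    have "0 = (\<Sum>i\<in>UNIV. r i * g p (e i) (e j))"
      using orth[OF eT, of j] sum[of UNIV r j] by (simp add: r)
    also have "\<dots> = r j * g p (e j) (e j)"
      by (subst sum.remove[of _ j]) (auto simp: e(4) intro!: sum.neutral)
    finally show ?thesis by (auto simp: e(4) split: if_splits)
  qed
  then show ?thesis by (simp add: r)
qed

lemma metric_eq_in_chart:
  assumes "c \<in> A" "p \<in> fst c" "u \<in> tangent_space A p" "v \<in> tangent_space A p"
  shows "g p u v = G c (snd c p) (u c) (v c)"
  using assms by (simp add: metric_in_chart_def tvec_of_component)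

text \<open>In the range of a chart the coordinate expression of the metric inherits symmetry, bilinearity
  and nondegeneracy from the tangent spaces. Outside the range it is arbitrary.\<close>

context
  fixes c x assumes c: "c \<in> A" and x: "x \<in> snd c ` fst c"
begin

lemma chart_inv_in: "chart_inv c x \<in> fst c" "chart_inv c x \<in> topspace X" "snd c (chart_inv c x) = x"
proof -
  show "chart_inv c x \<in> fst c" using x by (rule inv_into_into)
  then show "chart_inv c x \<in> topspace X" using c chart_domain_subset by blast
  show "snd c (chart_inv c x) = x" using x by (rule f_inv_into_f)
qed

lemma G_sym: "G c x u v = G c x v u"
  unfolding metric_in_chart_def
  by (rule metric_sym) (auto intro!: tvec_of_in_tangent_space c chart_inv_in)

lemma bilinear_G: "bilinear (G c x)"
proof -
  have l: "G c x (r *\<^sub>R u + s *\<^sub>R v) w = r * G c x u w + s * G c x v w" for r s u v w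
    unfolding metric_in_chart_def tvec_of_lincomb[OF c chart_inv_in(1)]
    by (rule metric_lincomb_left) (auto intro!: tvec_of_in_tangent_space c chart_inv_in)
  have "linear (\<lambda>u. G c x u w)" for w
    using l[of 1 _ 1 _ w] l[of _ _ 0 0 w] by (intro linearI) simp_all
  then show ?thesis by (simp add: bilinear_def G_sym)
qed

lemma G_nondegenerate:
  assumes "\<And>v. G c x u v = 0"
  shows "u = 0"
proof -
  have "tvec_of A c (chart_inv c x) u = 0"
  proof (rule metric_nondegenerate)
    show "g (chart_inv c x) (tvec_of A c (chart_inv c x) u) v = 0"
      if "v \<in> tangent_space A (chart_inv c x)" for v
      using assms[of "v c"] that c chart_inv_in(1) by (simp add: metric_in_chart_def tvec_of_component)
  qed (auto intro!: tvec_of_in_tangent_space c chart_inv_in)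
  then show ?thesis using tvec_of_chart[OF c chart_inv_in(1), of u] by simp
qed

lemma G_differentiable: "(\<lambda>y. G c y u v) differentiable (at x)"
  using lorentzian_manifold x c
  by (intro smooth_on_imp_differentiable) (auto simp: lorentzian_manifold_def)

lemmas G_lin = bilinear_ladd[OF bilinear_G] bilinear_lmul[OF bilinear_G] bilinear_lsub[OF bilinear_G]
  bilinear_radd[OF bilinear_G] bilinear_rmul[OF bilinear_G]

end

lemma tangent_null_frame_expansion:
  assumes p: "p \<in> topspace X" and T: "l \<in> tangent_space A p" "n \<in> tangent_space A p"
    "a \<in> tangent_space A p" "b \<in> tangent_space A p" "v \<in> tangent_space A p"
    and fr: "g p l l = 0" "g p n n = 0" "g p l n = 1" "g p l a = 0" "g p l b = 0"
    "g p n a = 0" "g p n b = 0" "g p a a = 1" "g p b b = 1" "g p a b = 0"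
  shows "v = g p v n *\<^sub>R l + g p v l *\<^sub>R n + g p v a *\<^sub>R a + g p v b *\<^sub>R b"
proof -
  define c where "c = chart_at A p"
  have c: "c \<in> A" "p \<in> fst c" unfolding c_def using chart_at[OF p] by blast+
  have x: "snd c p \<in> snd c ` fst c" using c by simp
  note ch = metric_eq_in_chart[OF c]
  show ?thesis
  proof (rule tangent_vector_eqI[OF c T(5)])
    show "g p v n *\<^sub>R l + g p v l *\<^sub>R n + g p v a *\<^sub>R a + g p v b *\<^sub>R b \<in> tangent_space A p"
      by (intro tangent_space_add tangent_space_scaleR T)
    show "v c = (g p v n *\<^sub>R l + g p v l *\<^sub>R n + g p v a *\<^sub>R a + g p v b *\<^sub>R b) c"
      using null_frame_expansion[OF bilinear_G[OF c(1) x] G_sym[OF c(1) x], of "l c" "n c" "a c" "b c" "v c"]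
        fr T by (simp add: ch)
  qed
qed

text \<open>The Koszul formula shows that the definite description of the Christoffel symbols has exactly one
  solution, so that they inherit its defining properties. Compatibility with the metric is what enters when inner
  products are differentiated along a curve.\<close>

lemma christoffel_compatible:
  assumes c: "c \<in> A" and p: "p \<in> fst c"
  shows "frechet_derivative (\<lambda>x. G c x u v) (at (snd c p)) w =
    G c (snd c p) (christoffel A g c p w u) v + G c (snd c p) u (christoffel A g c p w v)"
proof -
  let ?x = "snd c p"
  have x: "?x \<in> snd c ` fst c" using p by simp
  have "\<exists>!\<Gamma>. bilinear \<Gamma> \<and> (\<forall>u v. \<Gamma> u v = \<Gamma> v u) \<and>
    (\<forall>u v w. frechet_derivative (\<lambda>x. G c x u v) (at ?x) w = G c ?x (\<Gamma> w u) v + G c ?x u (\<Gamma> w v))"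
  proof (rule Koszul_unique_existence[OF bilinear_G[OF c x] G_sym[OF c x] G_nondegenerate[OF c x]])
    show "bilinear (\<lambda>u v. frechet_derivative (\<lambda>x. G c x u v) (at ?x) w)" for w
      by (rule bilinear_frechet_derivative[OF open_chart_range[OF c] x bilinear_G[OF c] G_differentiable[OF c x]])
    show "linear (frechet_derivative (\<lambda>x. G c x u v) (at ?x))" for u v
      by (rule linear_frechet_derivative[OF G_differentiable[OF c x]])
    show "frechet_derivative (\<lambda>x. G c x u v) (at ?x) w = frechet_derivative (\<lambda>x. G c x v u) (at ?x) w"
      for u v w
      using frechet_derivative_transform_within_open[OF G_differentiable[OF c x] open_chart_range[OF c] x
          G_sym[OF c]]
      by simp
  qed
  from theI'[OF this] show ?thesis unfolding christoffel_def[symmetric] by blast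
qed

lemma gradient_exists:
  assumes p: "p \<in> topspace X" and f: "smooth_function A f"
  shows "\<exists>!w. w \<in> tangent_space A p \<and> (\<forall>v\<in>tangent_space A p. g p w v = dir_deriv A p v f)"
proof -
  define c where "c = chart_at A p"
  have c: "c \<in> A" "p \<in> fst c" unfolding c_def using chart_at[OF p] by blast+
  then have x: "snd c p \<in> snd c ` fst c" by simp
  obtain u where u: "\<And>v. G c (snd c p) u v = frechet_derivative (f \<circ> chart_inv c) (at (snd c p)) v"
    using riesz_nondegenerate[OF bilinear_G[OF c(1) x] G_nondegenerate[OF c(1) x]
        has_derivative_linear[OF smooth_function_has_derivative[OF c f]]] by blast
  show ?thesis
  proof (rule ex1I[of _ "tvec_of A c p u"])
    show "tvec_of A c p u \<in> tangent_space A p \<and>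
      (\<forall>v\<in>tangent_space A p. g p (tvec_of A c p u) v = dir_deriv A p v f)"
      using c u dir_deriv_in_chart[OF c f]
      by (simp add: tvec_of_in_tangent_space metric_eq_in_chart[OF c])
  next
    fix w assume w: "w \<in> tangent_space A p \<and> (\<forall>v\<in>tangent_space A p. g p w v = dir_deriv A p v f)"
    have "G c (snd c p) (w c - u) v = 0" for v
    proof -
      have v: "tvec_of A c p v \<in> tangent_space A p" using c by (rule tvec_of_in_tangent_space)
      have "g p w (tvec_of A c p v) = dir_deriv A p (tvec_of A c p v) f" using w v by blast
      then have "G c (snd c p) (w c) v = G c (snd c p) u v"
        using w v c by (simp add: metric_eq_in_chart[OF c] dir_deriv_in_chart[OF c f] u)
      then show ?thesis by (simp add: G_lin[OF c(1) x])
    qed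
    then have "w c = u" using G_nondegenerate[OF c(1) x, of "w c - u"] by simp
    then show "w = tvec_of A c p u" using w tvec_of_component[OF c] by metis
  qed
qed

lemma
  assumes "p \<in> topspace X" "smooth_function A f"
  shows gradient_in_tangent_space: "gradient A g f p \<in> tangent_space A p"
    and metric_gradient: "v \<in> tangent_space A p \<Longrightarrow> g p (gradient A g f p) v = dir_deriv A p v f"
  using theI'[OF gradient_exists[OF assms]] by (simp_all add: gradient_def)

lemma G_gradient:
  assumes c: "c \<in> A" "p \<in> fst c" and f: "smooth_function A f"
  shows "G c (snd c p) (gradient A g f p c) u = frechet_derivative (f \<circ> chart_inv c) (at (snd c p)) u"
proof -
  have p: "p \<in> topspace X" using c chart_domain_subset by blast
  have u: "tvec_of A c p u \<in> tangent_space A p" using c by (rule tvec_of_in_tangent_space)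
  show ?thesis
    using metric_gradient[OF p f u] u gradient_in_tangent_space[OF p f] c
    by (simp add: metric_eq_in_chart[OF c] dir_deriv_in_chart[OF c f])
qed

text \<open>In coordinates the gradient solves the linear system whose matrix is that of the metric and whose
  right-hand side is the differential of \<open>f\<close>. Nondegeneracy makes the determinant nonzero.\<close>

lemma gradient_differentiable:
  assumes c: "c \<in> A" "p \<in> fst c" and f: "smooth_function A f"
  shows "(\<lambda>x. gradient A g f (chart_inv c x) c) differentiable (at (snd c p))"
proof -
  define M where "M x = (\<chi> i j. G c x (axis j 1) (axis i 1))" for x
  define b where "b x = (\<chi> i. frechet_derivative (f \<circ> chart_inv c) (at x) (axis i 1))" for x
  have x0: "snd c p \<in> snd c ` fst c" using c by simp
  have M: "(M x *v z) $ i = G c x z (axis i 1)" if x: "x \<in> snd c ` fst c" for x z i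
  proof -
    have lin: "linear (\<lambda>z. G c x z (axis i 1))"
      using bilinear_G[OF c(1) x] by (simp add: bilinear_def)
    have "G c x z (axis i 1) = G c x (\<Sum>j\<in>UNIV. z $ j *\<^sub>R axis j 1) (axis i 1)"
      by (simp add: basis_expansion flip: scalar_mult_eq_scaleR)
    also have "\<dots> = (\<Sum>j\<in>UNIV. z $ j * G c x (axis j 1) (axis i 1))"
      by (simp add: linear_sum[OF lin] linear_scale[OF lin])
    finally show ?thesis by (simp add: M_def matrix_vector_mult_def mult.commute)
  qed
  show ?thesis
  proof (rule differentiable_solution_of_linear_system[OF _ _ open_chart_range[OF c(1)] x0])
    show "(\<lambda>x. M x $ i $ j) differentiable (at (snd c p))" for i j
      by (simp add: M_def G_differentiable[OF c(1) x0])
    show "(\<lambda>x. b x $ i) differentiable (at (snd c p))" for i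
    proof -
      have "smooth_on (snd c ` fst c) (f \<circ> chart_inv c)"
        using c f by (simp add: smooth_function_def)
      from smooth_on_imp_differentiable_frechet_derivative[OF this x0] show ?thesis
        by (simp add: b_def)
    qed
    fix x assume x: "x \<in> snd c ` fst c"
    show "M x *v gradient A g f (chart_inv c x) c = b x"
      using G_gradient[OF c(1) chart_inv_in(1)[OF c(1) x] f]
      by (simp add: vec_eq_iff M[OF x] b_def chart_inv_in[OF c(1) x])
    have "inj ((*v) (M x))"
    proof (rule linear_injective_0[OF matrix_vector_mul_linear, THEN iffD2], intro allI impI)
      fix z assume z: "M x *v z = 0"
      have Gz: "linear (G c x z)" using bilinear_G[OF c(1) x] by (simp add: bilinear_def)
      have "G c x z b = 0" if "b \<in> Basis" for b
        using that z M[OF x, of z] by (auto simp: Basis_vec_def)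
      then have "G c x z = (\<lambda>v. 0)"
        by (intro linear_eq_stdbasis[OF Gz]) (auto simp: linear_iff)
      then show "z = 0" by (intro G_nondegenerate[OF c(1) x]) simp
    qed
    then show "det (M x) \<noteq> 0"
      by (simp add: inj_matrix_vector_mult matrix_left_invertible_injective invertible_det_nz[symmetric]
          invertible_left_inverse)
  qed
qed

text \<open>A vanishing Hessian makes the gradient parallel because the metric is nondegenerate.\<close>

lemma cov_deriv_gradient_eq_0:
  assumes p: "p \<in> topspace X" and u: "u \<in> tangent_space A p"
    and hess: "\<And>v. v \<in> tangent_space A p \<Longrightarrow> hessian A g f p u v = 0"
  shows "cov_deriv A g p u (gradient A g f) = 0"
proof (rule metric_nondegenerate[OF p])
  show "cov_deriv A g p u (gradient A g f) \<in> tangent_space A p"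
    using chart_at[OF p] by (simp add: cov_deriv_def Let_def tvec_of_in_tangent_space)
qed (use hess in \<open>simp add: hessian_def\<close>)

end


section \<open>Covariant differentiation along a curve\<close>

locale lorentzian_curve = lorentzian_manifold_locale X A g
  for X :: "'a topology" and A g +
  fixes I :: "real set" and \<alpha> :: "real \<Rightarrow> 'a"
  assumes open_I: "open I" and smooth_curve: "smooth_curve X A I \<alpha>"
begin

abbreviation D where "D \<equiv> cov_deriv_along A g \<alpha>"

text \<open>Differentiability is demanded at a single parameter, but tangency on the whole of \<open>I\<close>: the
  inner product of two fields has to be expressed in coordinates on a neighbourhood of the parameter.\<close>

definition differentiable_field :: "(real \<Rightarrow> 'a tvec) \<Rightarrow> real \<Rightarrow> bool" where
  "differentiable_field V t \<longleftrightarrow>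
     (\<forall>s\<in>I. V s \<in> tangent_space A (\<alpha> s)) \<and>
     (\<forall>c\<in>A. \<alpha> t \<in> fst c \<longrightarrow> (\<lambda>s. V s c) differentiable (at t))"

lemma curve_in_topspace: "t \<in> I \<Longrightarrow> \<alpha> t \<in> topspace X"
  using smooth_curve by (auto simp: smooth_curve_def continuous_map_def)

lemma open_curve_in_chart:
  assumes "c \<in> A"
  shows "open {t\<in>I. \<alpha> t \<in> fst c}"
proof -
  have "openin (top_of_set I) {t \<in> topspace (top_of_set I). \<alpha> t \<in> fst c}"
    using smooth_curve openin_chart_domain[OF assms] openin_continuous_map_preimage
    unfolding smooth_curve_def by blast
  then show ?thesis using open_I by (simp add: openin_open_eq)
qed

lemma curve_has_vector_derivative:
  assumes "c \<in> A" "t \<in> I" "\<alpha> t \<in> fst c"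
  shows "((\<lambda>s. snd c (\<alpha> s)) has_vector_derivative velocity A \<alpha> t c) (at t)"
proof -
  have "smooth_on {t\<in>I. \<alpha> t \<in> fst c} (snd c \<circ> \<alpha>)"
    using smooth_curve assms(1) by (simp add: smooth_curve_def)
  then have "(snd c \<circ> \<alpha>) differentiable (at t)"
    by (rule smooth_on_imp_differentiable) (use assms in auto)
  then show ?thesis using assms by (simp add: velocity_def vector_derivative_works[symmetric] o_def)
qed

text \<open>By the chain rule, the coordinate velocities in two charts are related by the Jacobian of the transition map.\<close>

lemma velocity_in_tangent_space:
  assumes t: "t \<in> I"
  shows "velocity A \<alpha> t \<in> tangent_space A (\<alpha> t)"
proof -
  have "velocity A \<alpha> t d = change_chart c d (\<alpha> t) (velocity A \<alpha> t c)"
    if c: "c \<in> A" "\<alpha> t \<in> fst c" and d: "d \<in> A" "\<alpha> t \<in> fst d" for c d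
  proof -
    have "((\<lambda>s. (snd d \<circ> chart_inv c) (snd c (\<alpha> s))) has_vector_derivative
        change_chart c d (\<alpha> t) (velocity A \<alpha> t c)) (at t)"
      by (rule has_vector_derivative_compose[OF curve_has_vector_derivative transition_has_derivative])
        (use c d t in auto)
    then have "((\<lambda>s. snd d (\<alpha> s)) has_vector_derivative
        change_chart c d (\<alpha> t) (velocity A \<alpha> t c)) (at t)"
      by (rule has_vector_derivative_transform_within_open[OF _ open_curve_in_chart[OF c(1)]])
        (use c t in auto)
    then show ?thesis
      using curve_has_vector_derivative[OF d(1) t d(2)] vector_derivative_unique_at by blast
  qed
  moreover have "velocity A \<alpha> t c = 0" if "\<not> (c \<in> A \<and> \<alpha> t \<in> fst c)" for c
    using that by (auto simp: velocity_def)
  ultimately show ?thesis unfolding tangent_space_def by blast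
qed

lemma velocity_differentiable_field:
  assumes t: "t \<in> I"
  shows "differentiable_field (velocity A \<alpha>) t"
  unfolding differentiable_field_def
proof (intro conjI ballI impI)
  fix c assume c: "c \<in> A" "\<alpha> t \<in> fst c"
  have "smooth_on {t\<in>I. \<alpha> t \<in> fst c} (snd c \<circ> \<alpha>)"
    using smooth_curve c by (simp add: smooth_curve_def)
  then have "(\<lambda>s. frechet_derivative (snd c \<circ> \<alpha>) (at s) 1) differentiable (at t)"
    by (rule smooth_on_imp_differentiable_frechet_derivative) (use c t in auto)
  moreover have "frechet_derivative (snd c \<circ> \<alpha>) (at s) 1 = velocity A \<alpha> s c"
    if "s \<in> {t\<in>I. \<alpha> t \<in> fst c}" for s
    using curve_has_vector_derivative[OF c(1), of s] that
    by (simp add: has_vector_derivative_def o_def frechet_derivative_at[symmetric])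
  ultimately show "(\<lambda>s. velocity A \<alpha> s c) differentiable (at t)"
    using open_curve_in_chart[OF c(1)] c t unfolding differentiable_def
    by (blast intro: has_derivative_transform_within_open)
qed (rule velocity_in_tangent_space)

lemma smooth_field_differentiable_field:
  assumes "smooth_field_along A I \<alpha> V" "t \<in> I"
  shows "differentiable_field V t"
  using assms unfolding differentiable_field_def smooth_field_along_def
  by (auto intro: smooth_on_imp_differentiable)

lemma cov_deriv_along_in_tangent_space: "t \<in> I \<Longrightarrow> D V t \<in> tangent_space A (\<alpha> t)"
  using chart_at[OF curve_in_topspace]
  by (simp add: cov_deriv_along_def Let_def tvec_of_in_tangent_space)

text \<open>Metric compatibility along a curve. In a chart, the derivative of the inner product is that of the
  metric entries plus the ordinary derivatives of the components. Compatibility splits the first contribution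
  into the two Christoffel terms that complete the ordinary derivatives to covariant ones.\<close>

lemma metric_has_derivative_along:
  assumes t: "t \<in> I" and U: "differentiable_field U t" and V: "differentiable_field V t"
  shows "((\<lambda>s. g (\<alpha> s) (U s) (V s)) has_real_derivative
    g (\<alpha> t) (D U t) (V t) + g (\<alpha> t) (U t) (D V t)) (at t)"
proof -
  define c where "c = chart_at A (\<alpha> t)"
  have c: "c \<in> A" "\<alpha> t \<in> fst c" unfolding c_def using chart_at[OF curve_in_topspace[OF t]] by blast+
  define x where "x s = snd c (\<alpha> s)" for s
  let ?v = "velocity A \<alpha> t c"
  let ?\<Gamma> = "christoffel A g c (\<alpha> t) ?v"
  let ?U' = "vector_derivative (\<lambda>s. U s c) (at t)" and ?V' = "vector_derivative (\<lambda>s. V s c) (at t)"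
  have xt: "x t \<in> snd c ` fst c" using c by (simp add: x_def)
  have UT: "U s \<in> tangent_space A (\<alpha> s)" and VT: "V s \<in> tangent_space A (\<alpha> s)" if "s \<in> I" for s
    using U V that by (auto simp: differentiable_field_def)
  have dU: "((\<lambda>s. U s c) has_vector_derivative ?U') (at t)" and dV: "((\<lambda>s. V s c) has_vector_derivative ?V') (at t)"
    using U V c by (auto simp: differentiable_field_def vector_derivative_works)
  have "((\<lambda>s. G c (x s) (U s c) (V s c)) has_real_derivative
      frechet_derivative (\<lambda>y. G c y (U t c) (V t c)) (at (x t)) ?v +
      G c (x t) ?U' (V t c) + G c (x t) (U t c) ?V') (at t)"
  proof (rule has_vector_derivative_varying_bilinear[where G="G c" and x=x, OF open_chart_range[OF c(1)] xt])
    show "(x has_vector_derivative ?v) (at t)"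
      using curve_has_vector_derivative[OF c(1) t c(2)] by (simp add: x_def[abs_def])
  qed (use bilinear_G[OF c(1)] G_differentiable[OF c(1) xt] dU dV in auto)
  then have "((\<lambda>s. g (\<alpha> s) (U s) (V s)) has_real_derivative
      frechet_derivative (\<lambda>y. G c y (U t c) (V t c)) (at (x t)) ?v +
      G c (x t) ?U' (V t c) + G c (x t) (U t c) ?V') (at t)"
    by (rule has_field_derivative_transform_within_open[OF _ open_curve_in_chart[OF c(1)]])
      (use t c UT VT metric_eq_in_chart[OF c(1)] in \<open>auto simp: x_def\<close>)
  moreover have "D U t c = ?U' + ?\<Gamma> (U t c)" "D V t c = ?V' + ?\<Gamma> (V t c)"
    using c by (simp_all add: cov_deriv_along_def c_def[symmetric])
  moreover have "g (\<alpha> t) (D U t) (V t) + g (\<alpha> t) (U t) (D V t) =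
      G c (x t) (D U t c) (V t c) + G c (x t) (U t c) (D V t c)"
    using metric_eq_in_chart[OF c] UT VT t cov_deriv_along_in_tangent_space by (simp add: x_def)
  ultimately show ?thesis
    using christoffel_compatible[OF c, of "U t c" "V t c" ?v]
    by (simp add: G_lin[OF c(1) xt] algebra_simps x_def[symmetric])
qed

text \<open>The chain rule: restricting a differentiable vector field of the manifold to the curve turns its covariant
  derivative in the direction of the velocity into the covariant derivative along the curve. Both are computed in the
  same chosen chart, so the Christoffel terms agree literally.\<close>

lemma
  assumes f: "smooth_function A f" and t: "t \<in> I"
  shows gradient_differentiable_field: "differentiable_field (\<lambda>s. gradient A g f (\<alpha> s)) t"
    and cov_deriv_along_gradient:
      "D (\<lambda>s. gradient A g f (\<alpha> s)) t = cov_deriv A g (\<alpha> t) (velocity A \<alpha> t) (gradient A g f)"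
proof -
  have *: "((\<lambda>s. gradient A g f (\<alpha> s) c) has_vector_derivative
      frechet_derivative (\<lambda>x. gradient A g f (chart_inv c x) c) (at (snd c (\<alpha> t))) (velocity A \<alpha> t c)) (at t)"
    if c: "c \<in> A" "\<alpha> t \<in> fst c" for c
  proof (rule has_vector_derivative_transform_within_open[OF _ open_curve_in_chart[OF c(1)]])
    show "((\<lambda>s. gradient A g f (chart_inv c (snd c (\<alpha> s))) c) has_vector_derivative
      frechet_derivative (\<lambda>x. gradient A g f (chart_inv c x) c) (at (snd c (\<alpha> t))) (velocity A \<alpha> t c)) (at t)"
      using has_vector_derivative_compose[OF curve_has_vector_derivative[OF c(1) t c(2)]
          gradient_differentiable[OF c f, unfolded frechet_derivative_works]] .
  qed (use c t in auto)
  show "differentiable_field (\<lambda>s. gradient A g f (\<alpha> s)) t"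
    using * gradient_in_tangent_space[OF curve_in_topspace f]
    by (auto simp: differentiable_field_def differentiable_def has_vector_derivative_def)
  show "D (\<lambda>s. gradient A g f (\<alpha> s)) t = cov_deriv A g (\<alpha> t) (velocity A \<alpha> t) (gradient A g f)"
    using vector_derivative_at[OF *] chart_at[OF curve_in_topspace[OF t]]
    by (simp add: cov_deriv_along_def cov_deriv_def Let_def)
qed

end


section \<open>Null eikonal helices\<close>

theorem theorem2:
  fixes X :: "'a topology" and A :: "'a chart set" and g :: "'a metric"
    and I :: "real set" and \<alpha> :: "real \<Rightarrow> 'a" and N W1 W2 :: "real \<Rightarrow> 'a tvec"
    and \<sigma>1 \<sigma>2 :: "real \<Rightarrow> real" and f :: "'a \<Rightarrow> real"
  assumes "lorentzian_manifold X A g"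
    and "open I" and "is_interval I" and "I \<noteq> {}"
    and "smooth_curve X A I \<alpha>"
    and "cartan_curve A g I \<alpha>"
    and "pseudo_arc_parametrized A g I \<alpha>"
    and "frenet_frame A g I \<alpha> N W1 W2 \<sigma>1 \<sigma>2"
    and "\<And>t. t \<in> I \<Longrightarrow> \<sigma>1 t \<noteq> 0" and "\<And>t. t \<in> I \<Longrightarrow> \<sigma>2 t \<noteq> 0"
    and "smooth_function A f"
    and "eikonal_along A g I \<alpha> f"
    and "\<And>p u v. \<lbrakk>p \<in> topspace X; u \<in> tangent_space A p; v \<in> tangent_space A p\<rbrakk>
            \<Longrightarrow> hessian A g f p u v = 0"
    and "null_eikonal_helix A g I \<alpha> f"
  shows "(\<forall>S. (\<forall>t\<in>I. (S has_real_derivative \<sigma>2 t) (at t)) \<longrightarrow>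
            (\<lambda>t. S t - deriv \<sigma>1 t / \<sigma>2 t) constant_on I) \<and>
         (\<exists>c. c \<noteq> 0 \<and> (\<forall>t\<in>I. g (\<alpha> t) (gradient A g f (\<alpha> t)) (velocity A \<alpha> t) = c) \<and>
            (\<exists>S. (\<forall>t\<in>I. (S has_real_derivative \<sigma>2 t) (at t)) \<and>
               (\<forall>t\<in>I. gradient A g f (\<alpha> t) =
                  c *\<^sub>R ((- \<sigma>1 t) *\<^sub>R velocity A \<alpha> t + N t + (- S t) *\<^sub>R W2 t)))) \<and>
         \<not> \<sigma>1 constant_on I"
proof -
  interpret lorentzian_curve X A g I \<alpha>
    using assms(1,2,5) by unfold_locales
  define \<xi> where "\<xi> = velocity A \<alpha>"
  define V where "V s = gradient A g f (\<alpha> s)" for s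
  obtain c where c: "c \<noteq> 0" "\<And>t. t \<in> I \<Longrightarrow> g (\<alpha> t) (V t) (\<xi> t) = c"
    using assms(14) by (auto simp: null_eikonal_helix_def V_def \<xi>_def)
  note fr = assms(8)[unfolded frenet_frame_def Let_def, folded \<xi>_def]
  have field: "differentiable_field V t" "differentiable_field \<xi> t" "differentiable_field N t"
      "differentiable_field W1 t" "differentiable_field W2 t" if "t \<in> I" for t
    using fr that gradient_differentiable_field[OF assms(11) that] velocity_differentiable_field[OF that]
    by (auto intro: smooth_field_differentiable_field simp: V_def[abs_def] \<xi>_def)
  then have T: "V t \<in> tangent_space A (\<alpha> t)" "\<xi> t \<in> tangent_space A (\<alpha> t)"
      "N t \<in> tangent_space A (\<alpha> t)" "W1 t \<in> tangent_space A (\<alpha> t)" "W2 t \<in> tangent_space A (\<alpha> t)"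
    if "t \<in> I" for t
    using that by (simp_all add: differentiable_field_def)
  \<comment> \<open>The two-term form of each right-hand side lets one linearity rule serve for all of them.\<close>
  have Frenet: "D \<xi> t = W1 t" "D N t = \<sigma>1 t *\<^sub>R W1 t + \<sigma>2 t *\<^sub>R W2 t"
      "D W1 t = (- \<sigma>1 t) *\<^sub>R \<xi> t + (-1) *\<^sub>R N t" "D W2 t = (- \<sigma>2 t) *\<^sub>R \<xi> t + 0 *\<^sub>R \<xi> t"
    if "t \<in> I" for t
    using fr that by simp_all
  have DV: "D V t = 0" if t: "t \<in> I" for t
    using cov_deriv_along_gradient[OF assms(11) t]
      cov_deriv_gradient_eq_0[OF curve_in_topspace[OF t] velocity_in_tangent_space[OF t]
        assms(13)[OF curve_in_topspace[OF t] velocity_in_tangent_space[OF t]]]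
    by (simp add: V_def[abs_def])
  have deriv_g: "((\<lambda>s. g (\<alpha> s) (V s) (Y s)) has_real_derivative g (\<alpha> t) (V t) (D Y t)) (at t)"
    if t: "t \<in> I" and Y: "differentiable_field Y t" for Y t
  proof -
    have "Y t \<in> tangent_space A (\<alpha> t)" using Y t by (simp add: differentiable_field_def)
    then have "g (\<alpha> t) 0 (Y t) = 0"
      using metric_scaleR_left[OF curve_in_topspace[OF t], of "Y t" "Y t" 0] by simp
    then show ?thesis
      using metric_has_derivative_along[OF t field(1)[OF t] Y] by (simp add: DV[OF t])
  qed
  have on_I: "(h' has_real_derivative d) (at t)"
    if "(h has_real_derivative d) (at t)" "t \<in> I" "\<And>s. s \<in> I \<Longrightarrow> h s = h' s" for h h' :: "real \<Rightarrow> real" and d t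
    using has_field_derivative_transform_within_open[OF that(1) assms(2) that(2,3)] .
  have lincomb: "g (\<alpha> t) (V t) (r *\<^sub>R u + s *\<^sub>R v) = r * g (\<alpha> t) (V t) u + s * g (\<alpha> t) (V t) v"
    if "t \<in> I" "u \<in> tangent_space A (\<alpha> t)" "v \<in> tangent_space A (\<alpha> t)" for t r s u v
    using metric_lincomb_right[OF curve_in_topspace] that T by simp
  \<comment> \<open>Differentiate in turn the constancy of the inner product with \<open>\<xi>\<close>, and then each identity so obtained.\<close>
  have VW1: "g (\<alpha> t) (V t) (W1 t) = 0" if t: "t \<in> I" for t
    using DERIV_unique[OF on_I[OF deriv_g[OF t field(2)[OF t]] t c(2)] DERIV_const] t
    by (simp add: Frenet)
  have VN: "g (\<alpha> t) (V t) (N t) = - c * \<sigma>1 t" if t: "t \<in> I" for t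
    using DERIV_unique[OF on_I[OF deriv_g[OF t field(4)[OF t]] t VW1] DERIV_const] t
    unfolding Frenet(3)[OF t] lincomb[OF t T(2,3)[OF t]] by (simp add: c(2) mult.commute)
  have \<sigma>1: "(\<sigma>1 has_real_derivative deriv \<sigma>1 t) (at t)" if t: "t \<in> I" for t
  proof -
    have "\<sigma>1 differentiable (at t)"
      using fr smooth_on_imp_differentiable t by blast
    then show ?thesis
      by (simp add: DERIV_deriv_iff_real_differentiable)
  qed
  have VW2: "g (\<alpha> t) (V t) (W2 t) = - c * (deriv \<sigma>1 t / \<sigma>2 t)" if t: "t \<in> I" for t
  proof -
    have "g (\<alpha> t) (V t) (D N t) = - c * deriv \<sigma>1 t"
      using DERIV_unique[OF on_I[OF deriv_g[OF t field(3)[OF t]] t VN] DERIV_cmult[OF \<sigma>1[OF t]]] .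
    then have "\<sigma>2 t * g (\<alpha> t) (V t) (W2 t) = - c * deriv \<sigma>1 t"
      unfolding Frenet(2)[OF t] lincomb[OF t T(4,5)[OF t]] by (simp add: VW1 t)
    then show ?thesis using assms(10)[OF t] by (simp add: field_simps)
  qed
  \<comment> \<open>The quotient is differentiable because it is a constant multiple of an inner product of fields.\<close>
  have S: "((\<lambda>s. deriv \<sigma>1 s / \<sigma>2 s) has_real_derivative \<sigma>2 t) (at t)" if t: "t \<in> I" for t
  proof -
    have "((\<lambda>s. - (1 / c) * g (\<alpha> s) (V s) (W2 s)) has_real_derivative
        - (1 / c) * g (\<alpha> t) (V t) (D W2 t)) (at t)"
      by (rule DERIV_cmult[OF deriv_g[OF t field(5)[OF t]]])
    moreover have "- (1 / c) * g (\<alpha> t) (V t) (D W2 t) = \<sigma>2 t"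
      unfolding Frenet(4)[OF t] lincomb[OF t T(2,2)[OF t]] using c t by simp
    ultimately have "((\<lambda>s. - (1 / c) * g (\<alpha> s) (V s) (W2 s)) has_real_derivative \<sigma>2 t) (at t)"
      by simp
    then show ?thesis
      by (rule on_I[OF _ t]) (use c(1) in \<open>simp add: VW2\<close>)
  qed
  have axis: "V t = c *\<^sub>R ((- \<sigma>1 t) *\<^sub>R \<xi> t + N t + (- (deriv \<sigma>1 t / \<sigma>2 t)) *\<^sub>R W2 t)" if t: "t \<in> I" for t
  proof -
    have "g (\<alpha> t) (\<xi> t) (\<xi> t) = 0"
      using assms(6) t by (simp add: cartan_curve_def null_curve_def \<xi>_def)
    then have "V t = g (\<alpha> t) (V t) (N t) *\<^sub>R \<xi> t + g (\<alpha> t) (V t) (\<xi> t) *\<^sub>R N t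
        + g (\<alpha> t) (V t) (W1 t) *\<^sub>R W1 t + g (\<alpha> t) (V t) (W2 t) *\<^sub>R W2 t"
      using fr t by (intro tangent_null_frame_expansion[OF curve_in_topspace[OF t]]) (simp_all add: T)
    then have "V t = (- c * \<sigma>1 t) *\<^sub>R \<xi> t + c *\<^sub>R N t + 0 *\<^sub>R W1 t + (- c * (deriv \<sigma>1 t / \<sigma>2 t)) *\<^sub>R W2 t"
      unfolding VN[OF t] c(2)[OF t] VW1[OF t] VW2[OF t] .
    then show ?thesis by (simp add: algebra_simps)
  qed
  have "(\<lambda>t. S t - deriv \<sigma>1 t / \<sigma>2 t) constant_on I"
    if S': "\<forall>t\<in>I. (S has_real_derivative \<sigma>2 t) (at t)" for S
  proof -
    have "((\<lambda>t. S t - deriv \<sigma>1 t / \<sigma>2 t) has_real_derivative 0) (at t within I)" if "t \<in> I" for t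
      using DERIV_diff[OF bspec[OF S' that] S[OF that]] by (simp add: has_field_derivative_at_within)
    then show ?thesis
      using has_field_derivative_zero_constant[OF is_interval_convex[OF assms(3)]]
      unfolding constant_on_def by blast
  qed
  \<comment> \<open>For constant \<open>\<sigma>1\<close> the zero function would be an antiderivative of \<open>\<sigma>2\<close>.\<close>
  moreover have "\<not> \<sigma>1 constant_on I"
  proof
    assume "\<sigma>1 constant_on I"
    then obtain k where k: "\<And>t. t \<in> I \<Longrightarrow> \<sigma>1 t = k" unfolding constant_on_def by blast
    obtain t where t: "t \<in> I" using assms(4) by blast
    have "deriv \<sigma>1 s = 0" if s: "s \<in> I" for s
      using DERIV_unique[OF on_I[OF \<sigma>1[OF s] s k] DERIV_const] .
    then have "\<sigma>2 t = 0"
      using DERIV_unique[OF on_I[OF S[OF t] t, of "\<lambda>s. 0"] DERIV_const] by simp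
    with assms(10)[OF t] show False ..
  qed
  ultimately show ?thesis
    using c S axis unfolding V_def \<xi>_def by blast
qed

end
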